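(* Let $n$ be a positive integer and let $w\in Q_n$ be an extremely lucky Stirling permutation. The displacement composition $\mathrm{dis}(w)$ uniquely determines $w$; that is, if $w'\in Q_n$ satisfies $\mathrm{dis}(w')=\mathrm{dis}(w)$, then $w'=w$.
   Context: A Stirling permutation of order $n$ is a permutation $w = w(1)w(2)\cdots w(2n)$ of the multiset $\{1,1,2,2,\ldots,n,n\}$ such that any value $j$ appearing between the two instances of $i$ satisfies $j>i$. $Q_n$ denotes the set of Stirling permutations of order $n$. Parking interpretation: there is a one-way street with spots $1,\ldots,2n$ (in this order), and cars $1,2,\ldots,2n$ arrive in order, car $i$ having preferred spot $w(i)$. Car $i$ parks in spot $w(i)$ if it is available; otherwise it continues down the street and parks in the first available spot after $w(i)$. For every $w\in Q_n$ all cars park. Car $i$ is lucky if it parks in its preferred spot $w(i)$, and unlucky otherwise. $\mathrm{lucky}(w)$ denotes the number of lucky cars of $w$. A Stirling permutation $w\in Q_n$ is extremely lucky if $\mathrm{lucky}(w)=n$. If car $i$ parks in spot $p(i)$, its displacement is $d(i)=p(i)-w(i)$. The displacement composition of $w\in Q_n$ is the tuple $\mathrm{dis}(w)=(d(1),d(2),\ldots,d(2n))\in\mathbb{N}^{2n}$, where $\mathbb{N}=\{0,1,2,\ldots\}$. *)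

theory Defs
  imports Main "HOL-Library.Multiset"
begin

definition stirling_perms :: "nat \<Rightarrow> nat list set" where
  "stirling_perms n = {w. mset w = (\<Sum>i\<in>{1..n}. {#i, i#}) \<and>
     (\<forall>a b c. a < b \<and> b < c \<and> c < length w \<and> w ! a = w ! c \<longrightarrow> w ! b > w ! a)}"

text \<open>
  The argument \<open>occ\<close> is the set of spots that are already taken; the result lists the
  spots in which the cars park, in order of arrival.  The street is not truncated at spot
  \<open>2 * n\<close>: lemma \<open>parking_outcome_in_street\<close> below shows that for Stirling permutations
  of order \<open>n\<close> no car ever leaves the spots \<open>1, \<dots>, 2 * n\<close>.
\<close>
primrec park :: "nat set \<Rightarrow> nat list \<Rightarrow> nat list" where
  "park occ [] = []"
| "park occ (a # as) =
     (let s = (LEAST s. a \<le> s \<and> s \<notin> occ) in s # park (insert s occ) as)"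

definition parking_outcome :: "nat list \<Rightarrow> nat list" where
  "parking_outcome w = park {} w"

definition lucky :: "nat list \<Rightarrow> nat" where
  "lucky w = card {i. i < length w \<and> parking_outcome w ! i = w ! i}"

definition extremely_lucky :: "nat \<Rightarrow> nat list \<Rightarrow> bool" where
  "extremely_lucky n w \<longleftrightarrow> w \<in> stirling_perms n \<and> lucky w = n"

text \<open>The subtraction on \<open>nat\<close> does not truncate here, by lemma \<open>parking_outcome_ge\<close>.\<close>
definition dis :: "nat list \<Rightarrow> nat list" where
  "dis w = map (\<lambda>i. parking_outcome w ! i - w ! i) [0..<length w]"

lemma length_park [simp]: "length (park occ w) = length w"
  by (induction w arbitrary: occ) (auto simp: Let_def)

lemma length_parking_outcome [simp]: "length (parking_outcome w) = length w"
  by (simp add: parking_outcome_def)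

lemma first_available:
  assumes "finite occ"
  shows "(a::nat) \<le> (LEAST s. a \<le> s \<and> s \<notin> occ) \<and> (LEAST s. a \<le> s \<and> s \<notin> occ) \<notin> occ"
proof -
  have "infinite ({a..} - occ)" using assms by (simp add: infinite_Ici)
  then have "{a..} - occ \<noteq> {}" by (metis finite.emptyI)
  then have "\<exists>s. a \<le> s \<and> s \<notin> occ" by auto
  then show ?thesis by (rule LeastI_ex)
qed

lemma park_ge: "finite occ \<Longrightarrow> i < length w \<Longrightarrow> w ! i \<le> park occ w ! i"
  by (induction w arbitrary: occ i)
     (auto simp: Let_def nth_Cons first_available split: nat.splits)

lemma parking_outcome_ge: "i < length w \<Longrightarrow> w ! i \<le> parking_outcome w ! i"
  by (simp add: parking_outcome_def park_ge)

lemma park_count: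
  assumes "finite occ"
    and "\<And>m. m \<notin> occ \<Longrightarrow> card (occ \<inter> {m<..}) \<le> size (filter_mset (\<lambda>x. x > m) M)"
    and "m \<notin> occ \<union> set (park occ w)"
  shows "card ((occ \<union> set (park occ w)) \<inter> {m<..}) \<le> size (filter_mset (\<lambda>x. x > m) (M + mset w))"
  using assms
proof (induction w arbitrary: occ M)
  case Nil
  then show ?case by simp
next
  case (Cons a w)
  define s where "s = (LEAST s. a \<le> s \<and> s \<notin> occ)"
  have s: "a \<le> s" "s \<notin> occ" using first_available[OF Cons.prems(1)] by (auto simp: s_def)
  have least: "s \<le> k" if "a \<le> k" "k \<notin> occ" for k
    unfolding s_def using that by (intro Least_le) auto
  have "card (insert s occ \<inter> {k<..}) \<le> size (filter_mset (\<lambda>x. x > k) (add_mset a M))"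
    if k: "k \<notin> insert s occ" for k
  proof (cases "k < a")
    case True
    then have "insert s occ \<inter> {k<..} = insert s (occ \<inter> {k<..})" using s by auto
    then show ?thesis using True s Cons.prems(1) Cons.prems(2)[of k] k by simp
  next
    case False
    then have "s < k" using least[of k] k by auto
    then have "insert s occ \<inter> {k<..} = occ \<inter> {k<..}" by auto
    then show ?thesis using False Cons.prems(2)[of k] k by simp
  qed
  moreover have eq: "occ \<union> set (park occ (a # w)) = insert s occ \<union> set (park (insert s occ) w)"
    by (simp add: s_def Let_def)
  ultimately have "card ((insert s occ \<union> set (park (insert s occ) w)) \<inter> {m<..})
      \<le> size (filter_mset (\<lambda>x. x > m) (add_mset a M + mset w))"
    using Cons.prems by (intro Cons.IH) auto
  then show ?case unfolding eq by simp
qed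

lemma size_filter_doubled:
  "size (filter_mset (\<lambda>x. x > m) (\<Sum>i\<in>{1..n}. {#i, i#})) = 2 * (n - m)"
  by (induction n) (auto simp: Suc_diff_le not_less)

lemma parking_outcome_in_street:
  assumes "w \<in> stirling_perms n"
  shows "set (parking_outcome w) \<subseteq> {1..2 * n}"
proof
  fix s assume s: "s \<in> set (parking_outcome w)"
  let ?O = "set (parking_outcome w)"
  have M: "mset w = (\<Sum>i\<in>{1..n}. {#i, i#})" using assms by (simp add: stirling_perms_def)
  have "set_mset (\<Sum>i\<in>{1..n}. {#i, i#}) = {1..n}" by (simp add: set_mset_sum)
  then have setw: "set w = {1..n}" using M by (metis set_mset_mset)
  have zero: "0 \<notin> ?O"
  proof
    assume "0 \<in> ?O"
    then obtain i where "i < length w" "parking_outcome w ! i = 0"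
      by (auto simp: in_set_conv_nth)
    then show False using parking_outcome_ge[of i w] setw nth_mem[of i w] by auto
  qed
  define m where "m = Max {k. k < s \<and> k \<notin> ?O}"
  have fin: "finite {k. k < s \<and> k \<notin> ?O}" by simp
  have ne: "0 \<in> {k. k < s \<and> k \<notin> ?O}" using zero s by (auto intro: gr0I)
  have m: "m < s" "m \<notin> ?O" using Max_in[OF fin] ne unfolding m_def by blast+
  have sub: "{m<..s} \<subseteq> ?O \<inter> {m<..}"
  proof
    fix k assume k: "k \<in> {m<..s}"
    have "k \<in> ?O"
    proof (rule ccontr)
      assume "k \<notin> ?O"
      then have "k < s" using k s by (cases "k = s") auto
      then have "k \<le> m" unfolding m_def using \<open>k \<notin> ?O\<close> by (intro Max_ge fin) auto
      then show False using k by simp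
    qed
    then show "k \<in> ?O \<inter> {m<..}" using k by simp
  qed
  have "card {m<..s} \<le> card (?O \<inter> {m<..})" using sub by (intro card_mono) auto
  also have "\<dots> \<le> size (filter_mset (\<lambda>x. x > m) (mset w))"
    using park_count[of "{}" "{#}" m w] m(2) by (simp add: parking_outcome_def)
  also have "\<dots> = 2 * (n - m)" unfolding M by (rule size_filter_doubled)
  finally show "s \<in> {1..2 * n}" using m(1) by simp
qed

end

theory Submission
  imports Defs
begin

text \<open>
  The second copy of a value is never lucky, so in an extremely lucky Stirling permutation the lucky
  cars are exactly those at first occurrences. An unlucky car cannot park in a spot \<open>v \<le> n\<close>, because
  that spot is taken by the first car preferring \<open>v\<close>; hence the unlucky cars fill the spots
  \<open>n + 1, n + 2, \<dots>\<close> in order. The \<open>k\<close>-th unlucky car therefore prefers \<open>n + k - d\<close>, where \<open>d\<close> is its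
  displacement, so the displacements determine the values at all second occurrences. At the last
  first occurrence where two candidates disagree, with values \<open>a\<close> and \<open>b\<close>, each candidate
  has its own value enclosed between the two copies of the other candidate's, and the Stirling
  condition yields both \<open>a < b\<close> and \<open>b < a\<close>.
\<close>

definition first_occs :: "'a list \<Rightarrow> nat set" where
  "first_occs w = {i. i < length w \<and> (\<forall>j<i. w ! j \<noteq> w ! i)}"

lemma first_occs_bij: "bij_betw ((!) w) (first_occs w) (set w)"
proof (rule bij_betw_imageI)
  show "inj_on ((!) w) (first_occs w)"
    by (rule inj_onI) (metis (mono_tags, lifting) first_occs_def mem_Collect_eq linorder_neqE_nat)
  have "\<exists>i\<in>first_occs w. w ! i = a" if "a \<in> set w" for a
  proof -
    have "\<exists>i. i < length w \<and> w ! i = a" using that by (simp add: in_set_conv_nth)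
    then obtain i where "i < length w \<and> w ! i = a" "\<forall>j<i. \<not> (j < length w \<and> w ! j = a)"
      using exists_least_iff[of "\<lambda>i. i < length w \<and> w ! i = a"] by blast
    then show ?thesis by (intro bexI[of _ i]) (auto simp: first_occs_def)
  qed
  then show "(!) w ` first_occs w = set w" by (force simp: first_occs_def)
qed

lemma card_first_occs: "card (first_occs w) = card (set w)"
  using bij_betw_same_card[OF first_occs_bij] .

lemma first_occ_exists:
  assumes "a \<in> set w"
  obtains i where "i \<in> first_occs w" "w ! i = a"
  using assms bij_betw_imp_surj_on[OF first_occs_bij[of w]] by (metis imageE)

text \<open>Trades the recursion for a description by arrival index, so that later arguments need no
  generalisation over \<open>occ\<close>.\<close>

lemma park_nth:
  assumes "i < length w"
  shows "park occ w ! i = (LEAST s. w ! i \<le> s \<and> s \<notin> occ \<union> set (take i (park occ w)))"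
  using assms
proof (induction w arbitrary: occ i)
  case (Cons a w)
  then show ?case by (cases i) (auto simp: Let_def)
qed simp

context
  fixes w :: "nat list" and i :: nat
  assumes i: "i < length w"
begin

lemma parking_outcome_notin: "parking_outcome w ! i \<notin> set (take i (parking_outcome w))"
  using first_available[of "set (take i (parking_outcome w))" "w ! i"] park_nth[OF i, of "{}"]
  by (simp add: parking_outcome_def)

lemma parking_outcome_le:
  assumes "w ! i \<le> s" "s \<notin> set (take i (parking_outcome w))"
  shows "parking_outcome w ! i \<le> s"
  using assms park_nth[OF i, of "{}"] by (auto simp: parking_outcome_def intro: Least_le)

end

lemma distinct_parking_outcome: "distinct (parking_outcome w)"
proof -
  have "parking_outcome w ! i \<noteq> parking_outcome w ! j" if "i < j" "j < length w" for i j
    using parking_outcome_notin[OF that(2)] that by (auto simp: in_set_conv_nth)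
  then show ?thesis
    by (metis distinct_conv_nth length_parking_outcome linorder_neqE_nat)
qed

definition lucky_cars :: "nat list \<Rightarrow> nat set" where
  "lucky_cars w = {i. i < length w \<and> parking_outcome w ! i = w ! i}"

text \<open>A spot that is free when car \<open>i\<close> arrives was also free for every earlier
  car, so an earlier car with the same preference would have taken it.\<close>

lemma lucky_cars_subset: "lucky_cars w \<subseteq> first_occs w"
proof
  fix i assume "i \<in> lucky_cars w"
  then have i: "i < length w" "parking_outcome w ! i = w ! i" by (auto simp: lucky_cars_def)
  have "w ! j \<noteq> w ! i" if "j < i" for j
  proof
    assume eq: "w ! j = w ! i"
    have free: "w ! i \<notin> set (take i (parking_outcome w))"
      using parking_outcome_notin[OF i(1)] i(2) by simp
    have "w ! j \<notin> set (take j (parking_outcome w))"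
      using free eq set_take_subset_set_take[of j i "parking_outcome w"] that by auto
    then have "parking_outcome w ! j = w ! j"
      using parking_outcome_le[of j w "w ! j"] parking_outcome_ge[of j w] that i by simp
    then show False using free eq that i by (auto simp: in_set_conv_nth)
  qed
  then show "i \<in> first_occs w" using i by (simp add: first_occs_def)
qed

lemma set_stirling_perm: "w \<in> stirling_perms n \<Longrightarrow> set w = {1..n}"
  using set_mset_mset[of w] by (simp add: stirling_perms_def set_mset_sum)

lemma count_stirling_perm:
  assumes "w \<in> stirling_perms n" "a \<in> set w"
  shows "count (mset w) a = 2"
proof -
  have "count (mset w) a = (\<Sum>i\<in>{1..n}. count {#i, i#} a)"
    using assms(1) by (simp add: stirling_perms_def count_sum)
  also have "\<dots> = (\<Sum>i\<in>{1..n}. if i = a then 2 else 0)" by (intro sum.cong) auto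
  finally show ?thesis using assms set_stirling_perm[OF assms(1)] by simp
qed

lemma length_stirling_perm: "w \<in> stirling_perms n \<Longrightarrow> length w = 2 * n"
  using size_mset[of w] by (simp add: stirling_perms_def size_multiset_sum)

lemma stirling_perm_less:
  "w \<in> stirling_perms n \<Longrightarrow> a < b \<Longrightarrow> b < c \<Longrightarrow> c < length w \<Longrightarrow> w ! a = w ! c \<Longrightarrow> w ! a < w ! b"
  by (simp add: stirling_perms_def)

lemma second_occ_exists:
  assumes w: "w \<in> stirling_perms n" and p: "p \<in> first_occs w"
  obtains q where "p < q" "q < length w" "w ! q = w ! p" "q \<notin> first_occs w"
proof -
  have "count (mset w) (w ! p) = 2"
    using count_stirling_perm[OF w] p by (simp add: first_occs_def)
  then have "card {i. i < length w \<and> w ! p = w ! i} = 2"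
    by (simp add: count_mset count_list_eq_length_filter length_filter_conv_card)
  then have "\<not> {i. i < length w \<and> w ! p = w ! i} \<subseteq> {p}"
    using card_mono[of "{p}" "{i. i < length w \<and> w ! p = w ! i}"] by force
  then obtain q where q: "q < length w" "w ! q = w ! p" "q \<noteq> p" by fastforce
  have "\<not> q < p" using p q(2) by (auto simp: first_occs_def)
  then have "p < q" using q(3) by simp
  moreover have "q \<notin> first_occs w" using \<open>p < q\<close> q(2) by (auto simp: first_occs_def)
  ultimately show thesis using that q by blast
qed

text \<open>Each of the \<open>n\<close> values has exactly one first occurrence, so the inclusion
  \<open>lucky_cars_subset\<close> is between sets of equal size.\<close>

lemma lucky_cars_eq:
  assumes w: "w \<in> stirling_perms n" and "lucky w = n"
  shows "lucky_cars w = first_occs w"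
proof (rule card_subset_eq)
  show "finite (first_occs w)" by (simp add: first_occs_def)
  show "card (lucky_cars w) = card (first_occs w)"
    using assms by (simp add: card_first_occs set_stirling_perm[OF w] lucky_def lucky_cars_def)
qed (rule lucky_cars_subset)

lemma unlucky_outcome_gt:
  assumes w: "w \<in> stirling_perms n" "lucky w = n"
    and i: "i < length w" "i \<notin> lucky_cars w"
  shows "n < parking_outcome w ! i"
proof (rule ccontr)
  assume le: "\<not> n < parking_outcome w ! i"
  have "w ! i \<in> {1..n}" using set_stirling_perm[OF w(1)] i nth_mem by blast
  then have "parking_outcome w ! i \<in> set w"
    using le parking_outcome_ge[OF i(1)] set_stirling_perm[OF w(1)] by auto
  then obtain f where f: "f \<in> first_occs w" "w ! f = parking_outcome w ! i"
    by (rule first_occ_exists)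
  then have f': "f \<in> lucky_cars w" using lucky_cars_eq[OF w] by simp
  then have "parking_outcome w ! f = parking_outcome w ! i" "f < length w"
    using f by (auto simp: lucky_cars_def)
  \<comment> \<open>The lucky car \<open>f\<close> already owns the spot, and no two cars share
    one.\<close>
  then have "f = i" using i distinct_parking_outcome[of w] by (simp add: nth_eq_iff_index_eq)
  then show False using f' i by simp
qed

text \<open>The inductive step for \<open>unlucky_outcomes\<close>, with \<open>prev\<close> as
  induction hypothesis: earlier unlucky cars fill exactly the spots directly after \<open>n\<close>,
  and lucky cars never pass \<open>n\<close>, so the next spot is the first one free beyond
  \<open>n\<close>.\<close>

lemma unlucky_outcome:
  assumes w: "w \<in> stirling_perms n" "lucky w = n"
    and i: "i < length w" "i \<notin> lucky_cars w"
    and prev: "(!) (parking_outcome w) ` ({..<i} - lucky_cars w)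
      = {n<..n + card ({..<i} - lucky_cars w)}"
  shows "parking_outcome w ! i = Suc (n + card ({..<i} - lucky_cars w))" (is "?p = Suc (n + ?c)")
proof (rule antisym)
  have pref: "w ! j \<le> n" if "j < length w" for j
    using set_stirling_perm[OF w(1)] nth_mem[OF that] by auto
  have "Suc (n + ?c) \<notin> set (take i (parking_outcome w))"
  proof
    assume "Suc (n + ?c) \<in> set (take i (parking_outcome w))"
    then obtain j where j: "j < i" "parking_outcome w ! j = Suc (n + ?c)"
      by (auto simp: in_set_conv_nth)
    show False
    proof (cases "j \<in> lucky_cars w")
      case True
      then show False using j pref[of j] by (simp add: lucky_cars_def)
    next
      case False
      then have "Suc (n + ?c) \<in> {n<..n + ?c}" using j unfolding prev[symmetric] by force
      then show False by simp
    qed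
  qed
  then show "?p \<le> Suc (n + ?c)" using pref[OF i(1)] by (intro parking_outcome_le i(1)) auto
  \<comment> \<open>By \<open>prev\<close> these spots are taken, which together with
    \<open>n < ?p\<close> leaves only spots from \<open>Suc (n + ?c)\<close> on.\<close>
  have "?p \<notin> {n<..n + ?c}"
    unfolding prev[symmetric] using parking_outcome_notin[OF i(1)] i
    by (auto simp: in_set_conv_nth)
  then show "Suc (n + ?c) \<le> ?p" using unlucky_outcome_gt[OF w i] by simp
qed

lemma unlucky_outcomes:
  assumes w: "w \<in> stirling_perms n" "lucky w = n" and "i \<le> length w"
  shows "(!) (parking_outcome w) ` ({..<i} - lucky_cars w)
    = {n<..n + card ({..<i} - lucky_cars w)}"
  using assms(3)
proof (induction i)
  case (Suc i)
  show ?case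
  proof (cases "i \<in> lucky_cars w")
    case True
    then have "{..<Suc i} - lucky_cars w = {..<i} - lucky_cars w" by (auto simp: less_Suc_eq)
    then show ?thesis using Suc by simp
  next
    case False
    then have *: "{..<Suc i} - lucky_cars w = insert i ({..<i} - lucky_cars w)"
      by (auto simp: less_Suc_eq)
    have "parking_outcome w ! i = Suc (n + card ({..<i} - lucky_cars w))"
      using Suc False by (intro unlucky_outcome[OF w]) auto
    then show ?thesis unfolding * using Suc by auto
  qed
qed simp

lemma dis_nth: "i < length w \<Longrightarrow> dis w ! i = parking_outcome w ! i - w ! i"
  by (simp add: dis_def)

text \<open>No car parks before its preferred spot, so a zero natural-number difference means
  equality.\<close>

lemma lucky_cars_dis: "lucky_cars w = {i. i < length (dis w) \<and> dis w ! i = 0}"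
  using parking_outcome_ge[of _ w] by (auto simp: lucky_cars_def dis_def intro: antisym)

lemma lucky_dis: "lucky w = card {i. i < length (dis w) \<and> dis w ! i = 0}"
  unfolding lucky_cars_dis[symmetric] by (simp add: lucky_def lucky_cars_def)

text \<open>The right-hand side depends on \<open>w\<close> only through \<open>n\<close> and
  \<open>dis w\<close>, because \<open>lucky_cars w\<close> can itself be read off from
  \<open>dis w\<close>.\<close>

lemma second_occ_value:
  assumes w: "w \<in> stirling_perms n" "lucky w = n"
    and i: "i < length w" "i \<notin> lucky_cars w"
  shows "w ! i = Suc (n + card ({..<i} - lucky_cars w)) - dis w ! i"
proof -
  have "parking_outcome w ! i = Suc (n + card ({..<i} - lucky_cars w))"
    using unlucky_outcome[OF w i] unlucky_outcomes[OF w] i by simp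
  then show ?thesis using parking_outcome_ge[OF i(1)] dis_nth[OF i(1)] by simp
qed

text \<open>Stated for one direction only, so that exchanging \<open>w\<close> and \<open>w'\<close>
  gives the opposite inequality. In \<open>w'\<close> the value \<open>w ! p\<close> keeps its
  second position \<open>q\<close>, while its first position must lie before
  \<open>p\<close>.\<close>

lemma last_difference_less:
  assumes w: "w \<in> stirling_perms n" and w': "w' \<in> stirling_perms n"
    and same: "first_occs w' = first_occs w"
    and second: "\<And>i. i < length w \<Longrightarrow> i \<notin> first_occs w \<Longrightarrow> w' ! i = w ! i"
    and p: "p \<in> first_occs w" "w' ! p \<noteq> w ! p"
    and later: "\<And>i. i \<in> first_occs w \<Longrightarrow> p < i \<Longrightarrow> w' ! i = w ! i"
  shows "w ! p < w' ! p"
proof -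
  have len: "length w' = length w" using w w' by (simp add: length_stirling_perm)
  obtain q where q: "p < q" "q < length w" "w ! q = w ! p" "q \<notin> first_occs w"
    using second_occ_exists[OF w p(1)] .
  then have q': "w' ! q = w ! p" using second by simp
  then have "w ! p \<in> set w'" using q len by (metis nth_mem)
  then obtain p' where p': "p' \<in> first_occs w'" "w' ! p' = w ! p" by (rule first_occ_exists)
  have "p' < p"
  proof (rule ccontr)
    assume "\<not> p' < p"
    then have "p < p'" using p' p(2) by (cases "p = p'") auto
    \<comment> \<open>Agreement beyond \<open>p\<close> would make \<open>p'\<close> a repeated
      occurrence of \<open>w ! p\<close> in \<open>w\<close>, although it is a first one.\<close>
    then have "w ! p' = w ! p" using later[of p'] p' same by simp
    then show False using \<open>p < p'\<close> p'(1) unfolding same by (auto simp: first_occs_def)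
  qed
  then show ?thesis using stirling_perm_less[OF w', of p' p q] q q' p' len by simp
qed

theorem theorem5p8:
  fixes n :: nat and w w' :: "nat list"
  assumes "n \<ge> 1"
    and "w \<in> stirling_perms n"
    and "extremely_lucky n w"
    and "w' \<in> stirling_perms n"
    and "dis w' = dis w"
  shows "w' = w"
proof (rule ccontr)
  assume ne: "w' \<noteq> w"
  note w = assms(2) and w' = assms(4)
  have l: "lucky w = n" using assms(3) by (simp add: extremely_lucky_def)
  \<comment> \<open>Extreme luck is assumed for \<open>w\<close> only; it passes to
    \<open>w'\<close> because the lucky cars are the zeros of the displacement composition.\<close>
  then have l': "lucky w' = n" using assms(5) by (simp add: lucky_dis)
  have lc: "lucky_cars w' = lucky_cars w" using assms(5) by (simp add: lucky_cars_dis)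
  then have same: "first_occs w' = first_occs w"
    using lucky_cars_eq[OF w l] lucky_cars_eq[OF w' l'] by simp
  have len: "length w' = length w" using w w' by (simp add: length_stirling_perm)
  have second: "w' ! i = w ! i" if "i < length w" "i \<notin> first_occs w" for i
    using second_occ_value[OF w l, of i] second_occ_value[OF w' l', of i] that lc len assms(5)
    by (simp add: lucky_cars_eq[OF w l])
  \<comment> \<open>By \<open>second\<close>, all disagreements lie at first occurrences, so the
    largest one can serve as \<open>p\<close> in \<open>last_difference_less\<close>.\<close>
  define D where "D = {i. i < length w \<and> w' ! i \<noteq> w ! i}"
  have "finite D" "D \<noteq> {}" using ne len nth_equalityI[of w' w] by (auto simp: D_def)
  then have mx: "Max D \<in> D" "\<And>i. i \<in> D \<Longrightarrow> i \<le> Max D" by auto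
  have p: "Max D \<in> first_occs w" "w' ! Max D \<noteq> w ! Max D" using mx(1) second by (auto simp: D_def)
  have later: "w' ! i = w ! i" if "i \<in> first_occs w" "Max D < i" for i
  proof -
    have "i \<notin> D" using that(2) mx(2)[of i] by linarith
    then show ?thesis using that(1) by (simp add: D_def first_occs_def)
  qed
  have "w ! Max D < w' ! Max D"
    using last_difference_less[OF w w' same second p later] by simp
  moreover have "w' ! Max D < w ! Max D"
    using last_difference_less[OF w' w same[symmetric], of "Max D"] second p later same len
    by simp
  ultimately show False by simp
qed

end
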